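(* Let $(X,\tau_1,\tau_2)$ be a bitopological space with $\tau_1\subset\tau_2$ and $(X,\tau_1)$ a $T_1$ space. Then the following implications hold: (a) if $(X,\tau_1,\tau_2)$ is a $1$-$I$-space, then it is a $(2,1)$-$I$-space; (b) if $(X,\tau_1,\tau_2)$ is a $1$-$I$-space, then it is a $(1,2)$-$I$-space; (c) if $(X,\tau_1,\tau_2)$ is a $(2,1)$-$I$-space, then it is a $2$-$I$-space; (d) if $(X,\tau_1,\tau_2)$ is a $(1,2)$-$I$-space, then it is a $2$-$I$-space.
   Context: A bitopological space is a set with two topologies. $X_j^d$ is the set of $\tau_j$-accumulation (i.e. non-$\tau_j$-isolated) points of $X$. A set $A$ is $i$-discrete if every point of $A$ is $\tau_i$-isolated in $A$. For $i,j\in\{1,2\}$, $i\neq j$, $(X,\tau_1,\tau_2)$ is an $(i,j)$-$I$-space if $X_j^d$ is $\tau_j$-closed and $i$-discrete; it is an $i$-$I$-space if $X_i^d$ is $\tau_i$-closed and $i$-discrete. *)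

theory Defs
  imports "HOL-Analysis.Analysis"
begin

definition bitopological_space :: "'a topology \<Rightarrow> 'a topology \<Rightarrow> bool" where
  "bitopological_space \<tau>1 \<tau>2 \<longleftrightarrow> topspace \<tau>1 = topspace \<tau>2"

text \<open>Inclusion of the families of open sets, not necessarily strict.\<close>

definition topology_included :: "'a topology \<Rightarrow> 'a topology \<Rightarrow> bool" where
  "topology_included \<tau>1 \<tau>2 \<longleftrightarrow> {U. openin \<tau>1 U} \<subseteq> {U. openin \<tau>2 U}"

definition accumulation_points :: "'a topology \<Rightarrow> 'a set" where
  "accumulation_points \<tau> = \<tau> derived_set_of (topspace \<tau>)"

definition topology_isolated_in :: "'a topology \<Rightarrow> 'a \<Rightarrow> 'a set \<Rightarrow> bool" where
  "topology_isolated_in \<tau> x A \<longleftrightarrow> x \<in> A \<and> (\<exists>U. openin \<tau> U \<and> U \<inter> A = {x})"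

definition discrete_in :: "'a topology \<Rightarrow> 'a set \<Rightarrow> bool" where
  "discrete_in \<tau> A \<longleftrightarrow> (\<forall>x\<in>A. topology_isolated_in \<tau> x A)"

text \<open>
  For a bitopological space with topologies \<open>\<tau>1\<close>, \<open>\<tau>2\<close>, the \<open>(i,j)\<close>-\<open>I\<close>-spaces are given by
  \<open>pair_I_space \<tau>i \<tau>j\<close> and the \<open>i\<close>-\<open>I\<close>-spaces by \<open>I_space \<tau>i\<close>. In the former the second
  topology determines the accumulation points and the closedness, the first one the discreteness.
\<close>

definition pair_I_space :: "'a topology \<Rightarrow> 'a topology \<Rightarrow> bool" where
  "pair_I_space \<tau>i \<tau>j \<longleftrightarrow>
     closedin \<tau>j (accumulation_points \<tau>j) \<and> discrete_in \<tau>i (accumulation_points \<tau>j)"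

definition I_space :: "'a topology \<Rightarrow> bool" where
  "I_space \<tau>i \<longleftrightarrow>
     closedin \<tau>i (accumulation_points \<tau>i) \<and> discrete_in \<tau>i (accumulation_points \<tau>i)"

end

theory Submission
  imports Defs
begin

text \<open>
  The accumulation points are the points whose singleton is not open, so they always form a closed
  set, and refining the topology shrinks this set. Hence only the discreteness conditions matter,
  and these survive both refining the topology and passing to a subset.
\<close>

text \<open>Open sets lie in \<open>topspace \<tau>\<close>, so an open \<open>U\<close> around
  \<open>x\<close> that contains no other point of the space can only be \<open>{x}\<close>.\<close>

lemma accumulation_points_eq: "accumulation_points \<tau> = {x \<in> topspace \<tau>. \<not> openin \<tau> {x}}"
proof -
  have "(\<forall>U. x \<in> U \<and> openin \<tau> U \<longrightarrow> (\<exists>y. y \<noteq> x \<and> y \<in> topspace \<tau> \<and> y \<in> U)) \<longleftrightarrow>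
      \<not> openin \<tau> {x}" (is "?L \<longleftrightarrow> ?R") for x
  proof
    assume ?L
    \<comment> \<open>An open \<open>{x}\<close> would itself be a neighbourhood \<open>U\<close>
      without a second point.\<close>
    then show ?R
      by (metis singleton_iff)
  next
    assume R: ?R
    show ?L
    proof (intro allI impI)
      fix U assume U: "x \<in> U \<and> openin \<tau> U"
      with R have "U \<noteq> {x}"
        by auto
      with U obtain y where "y \<in> U" "y \<noteq> x"
        by blast
      with U show "\<exists>y. y \<noteq> x \<and> y \<in> topspace \<tau> \<and> y \<in> U"
        using openin_subset by blast
    qed
  qed
  then show ?thesis
    by (simp add: accumulation_points_def derived_set_of_def)
qed

lemma closedin_accumulation_points: "closedin \<tau> (accumulation_points \<tau>)"
proof -
  \<comment> \<open>The complement consists of the isolated points, hence is a union of open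
    singletons.\<close>
  have "topspace \<tau> - accumulation_points \<tau> = \<Union>{{x} |x. openin \<tau> {x}}"
    by (auto simp: accumulation_points_eq dest: openin_subset)
  moreover have "openin \<tau> (\<Union>{{x} |x. openin \<tau> {x}})"
    by (rule openin_Union) blast
  ultimately show ?thesis
    by (auto simp: closedin_def accumulation_points_eq)
qed

lemma accumulation_points_antimono:
  assumes "bitopological_space \<tau>1 \<tau>2" "topology_included \<tau>1 \<tau>2"
  shows "accumulation_points \<tau>2 \<subseteq> accumulation_points \<tau>1"
  using assms
  by (auto simp: accumulation_points_eq bitopological_space_def topology_included_def)

text \<open>The open set isolating \<open>x\<close> in \<open>A\<close> also works for
  \<open>B\<close>: it stays open in the finer topology, and \<open>U \<inter> B\<close> lies in
  \<open>U \<inter> A = {x}\<close> and contains \<open>x\<close>.\<close>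

lemma discrete_in_mono:
  assumes "topology_included \<sigma> \<tau>" "B \<subseteq> A" "discrete_in \<sigma> A"
  shows "discrete_in \<tau> B"
  unfolding discrete_in_def topology_isolated_in_def
proof (intro ballI conjI)
  fix x assume x: "x \<in> B"
  then obtain U where "openin \<sigma> U" "U \<inter> A = {x}"
    using assms(2,3) unfolding discrete_in_def topology_isolated_in_def by blast
  with assms(1,2) x have "openin \<tau> U \<and> U \<inter> B = {x}"
    unfolding topology_included_def by blast
  then show "\<exists>U. openin \<tau> U \<and> U \<inter> B = {x}" ..
qed

theorem proposition3p17:
  fixes \<tau>1 \<tau>2 :: "'a topology"
  assumes "bitopological_space \<tau>1 \<tau>2"
    and "topology_included \<tau>1 \<tau>2"
    and "t1_space \<tau>1"
  shows "(I_space \<tau>1 \<longrightarrow> pair_I_space \<tau>2 \<tau>1) \<and>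
         (I_space \<tau>1 \<longrightarrow> pair_I_space \<tau>1 \<tau>2) \<and>
         (pair_I_space \<tau>2 \<tau>1 \<longrightarrow> I_space \<tau>2) \<and>
         (pair_I_space \<tau>1 \<tau>2 \<longrightarrow> I_space \<tau>2)"
proof -
  have refl: "topology_included \<tau> \<tau>" for \<tau> :: "'a topology"
    by (simp add: topology_included_def)
  note antimono = accumulation_points_antimono[OF assms(1,2)]
  show ?thesis
    unfolding I_space_def pair_I_space_def
    \<comment> \<open>The first instance refines the topology on a fixed set, for implications (a)
      and (d); the second shrinks the set under a fixed topology, for (b) and (c).\<close>
    using discrete_in_mono[OF assms(2) order_refl] discrete_in_mono[OF refl antimono]
    by (simp add: closedin_accumulation_points)
qed

end
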